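(* Let $n\ge 0$ be an integer and let $q\ge 1$ be an odd integer. Then $$\sum_{k=0}^{n+q}\binom{n+q}{k}\left(\prod_{j=1}^{q}(n+k+j)\right)B_{n+k}=0.$$
   Context: $B_n$ denotes the $n$-th Bernoulli number, $B_n=B_n(0)$, where the Bernoulli polynomials $B_n(x)$ are defined by $\frac{z}{e^{z}-1}e^{xz}=\sum_{n=0}^{\infty}B_n(x)\frac{z^n}{n!}$. In particular $B_0=1$ and $B_1=-\tfrac12$. *)

theory Defs
  imports Complex_Main "HOL-Computational_Algebra.Formal_Power_Series"
begin

(* The generating function z e^(xz) / (e^z - 1) is read as a formal power series in z.
   The divisor has zero constant term, but its subdegree is 1, the same as that of fps_X,
   so the division is exact; bernpoly_gf below confirms this. *)
definition bernpoly :: "nat \<Rightarrow> real \<Rightarrow> real" where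
  "bernpoly n x = fact n * fps_nth (fps_X / (fps_exp 1 - 1) * fps_exp x) n"

definition bernoulli :: "nat \<Rightarrow> real" where
  "bernoulli n = bernpoly n 0"

lemma bernpoly_gf:
  "Abs_fps (\<lambda>n. bernpoly n x / fact n) * (fps_exp 1 - 1) = fps_X * fps_exp x"
proof -
  let ?d = "fps_exp 1 - 1 :: real fps"
  have "fps_nth ?d 1 \<noteq> 0"
    by simp
  then have nz: "?d \<noteq> 0"
    by (metis fps_zero_nth)
  have "subdegree ?d = 1"
    by (rule subdegreeI) auto
  then have "?d dvd fps_X"
    using nz by (simp add: fps_dvd_iff)
  then have div: "fps_X / ?d * ?d = fps_X"
    by (rule dvd_div_mult_self)
  have "Abs_fps (\<lambda>n. bernpoly n x / fact n) = fps_X / ?d * fps_exp x"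
    by (rule fps_ext) (simp add: bernpoly_def)
  then have "Abs_fps (\<lambda>n. bernpoly n x / fact n) * ?d = (fps_X / ?d * ?d) * fps_exp x"
    by (simp only: ac_simps)
  then show ?thesis
    by (simp only: div)
qed

end

theory Submission
  imports Defs "HOL-Computational_Algebra.Polynomial"
begin

text \<open>
  Let \<open>L\<close> be the linear functional on polynomials with \<open>L(x^m) = B\<^sub>m\<close>. The generating function
  satisfies \<open>F(-z) = F(z) e^z\<close>, which says that \<open>L\<close> is invariant under \<open>x \<mapsto> -1 - x\<close>.
  With \<open>N = n + q\<close>, the sum is \<open>L\<close> applied to the \<open>q\<close>-th derivative of \<open>x^N (1 + x)^N\<close>.
  As \<open>x^N (1 + x)^N\<close> is fixed by \<open>x \<mapsto> -1 - x\<close> and \<open>q\<close> is odd, this derivative is mapped to its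
  negative, so its image under \<open>L\<close> vanishes.
\<close>

text \<open>This compares coefficients of \<open>z^m\<close> in \<open>F(z) e^z = F(-z)\<close>; it
  will be the invariance of \<open>L\<close> on the monomial \<open>x^m\<close>.\<close>

lemma bernoulli_reflect:
  "(\<Sum>k\<le>m. real (m choose k) * bernoulli k) = (-1) ^ m * bernoulli m"
proof -
  define F where "F = Abs_fps (\<lambda>n. bernoulli n / fact n)"
  let ?E = "fps_exp 1 :: real fps"
  have F: "F * (?E - 1) = fps_X"
    using bernpoly_gf[of 0] by (simp add: F_def bernoulli_def)
  \<comment> \<open>Substitute \<open>-z\<close> for \<open>z\<close> in
    \<open>F(z) (e^z - 1) = z\<close>. Multiplying by \<open>e^z\<close> then turns the factor
    \<open>e^(-z) - 1\<close> into \<open>1 - e^z\<close>, so that \<open>F(-z)\<close> and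
    \<open>F(z) e^z\<close> can be compared by cancelling \<open>e^z - 1\<close>.\<close>
  have "(F oo (- fps_X)) * ((?E - 1) oo (- fps_X)) = - fps_X"
    using arg_cong[OF F, of "\<lambda>f. f oo (- fps_X)"]
    by (simp add: fps_compose_mult_distrib)
  moreover have "?E oo (- fps_X) = fps_exp (-1)"
    by (simp add: fps_compose_uminus' fps_eq_iff)
  ultimately have "(F oo (- fps_X)) * (fps_exp (-1) - 1) = - fps_X"
    by (simp add: fps_compose_sub_distrib)
  then have "(F oo (- fps_X)) * ((fps_exp (-1) - 1) * ?E) = - fps_X * ?E"
    by (metis mult.assoc)
  moreover have "(fps_exp (-1) - 1) * ?E = 1 - ?E"
    using fps_exp_add_mult[of "-1::real" 1] by (simp add: algebra_simps)
  ultimately have "(F oo (- fps_X)) * (1 - ?E) = - fps_X * ?E"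
    by simp
  then have "(F oo (- fps_X)) * (?E - 1) = fps_X * ?E"
    by (simp add: right_diff_distrib) (simp add: diff_eq_eq eq_diff_eq add.commute)
  also have "\<dots> = (F * ?E) * (?E - 1)"
    by (simp add: F[symmetric] ac_simps)
  finally have "(F oo (- fps_X)) * (?E - 1) = (F * ?E) * (?E - 1)" .
  moreover have "fps_nth (?E - 1) 1 \<noteq> 0"
    by simp
  then have "?E - 1 \<noteq> 0"
    by (metis fps_zero_nth)
  ultimately have "F * ?E = F oo (- fps_X)"
    by simp
  then have "fps_nth (F * ?E) m = (-1) ^ m * bernoulli m / fact m"
    by (simp add: fps_compose_uminus' F_def)
  moreover have "fps_nth (F * ?E) m = (\<Sum>k\<le>m. real (m choose k) * bernoulli k) / fact m"
    by (simp add: F_def fps_mult_nth atLeast0AtMost sum_divide_distrib binomial_fact)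
  ultimately show ?thesis
    by simp
qed

definition bernoulli_umbral :: "real poly \<Rightarrow> real" where
  "bernoulli_umbral p = (\<Sum>i\<le>degree p. coeff p i * bernoulli i)"

text \<open>Coefficients above the degree vanish. A bound common to two polynomials makes additivity
  a termwise matter.\<close>

lemma bernoulli_umbral_eq:
  assumes "degree p \<le> M"
  shows "bernoulli_umbral p = (\<Sum>i\<le>M. coeff p i * bernoulli i)"
  unfolding bernoulli_umbral_def
  using assms by (intro sum.mono_neutral_left) (auto simp: coeff_eq_0)

lemma bernoulli_umbral_add:
  "bernoulli_umbral (p + r) = bernoulli_umbral p + bernoulli_umbral r"
proof -
  let ?M = "max (degree p) (degree r)"
  have "degree (p + r) \<le> ?M"
    by (rule degree_add_le_max)
  then show ?thesis
    by (simp add: bernoulli_umbral_eq[of _ ?M] distrib_right sum.distrib)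
qed

lemma bernoulli_umbral_smult: "bernoulli_umbral (smult c p) = c * bernoulli_umbral p"
  by (simp add: bernoulli_umbral_eq[OF degree_smult_le] bernoulli_umbral_def[of p]
      sum_distrib_left mult.assoc)

lemma bernoulli_umbral_0: "bernoulli_umbral 0 = 0"
  by (simp add: bernoulli_umbral_def)

lemma bernoulli_umbral_sum:
  "bernoulli_umbral (\<Sum>i\<in>A. f i) = (\<Sum>i\<in>A. bernoulli_umbral (f i))"
  by (induction A rule: infinite_finite_induct)
    (simp_all add: bernoulli_umbral_0 bernoulli_umbral_add)

lemma bernoulli_umbral_monom: "bernoulli_umbral (monom c m) = c * bernoulli m"
proof -
  have "bernoulli_umbral (monom c m) = (\<Sum>i\<le>m. coeff (monom c m) i * bernoulli i)"
    by (rule bernoulli_umbral_eq) (rule degree_monom_le)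
  also have "\<dots> = (\<Sum>i\<le>m. if i = m then c * bernoulli m else 0)"
    by (rule sum.cong) auto
  finally show ?thesis
    by simp
qed

lemma one_plus_X_power:
  "[:1, 1:] ^ m = (\<Sum>k\<le>m. monom (of_nat (m choose k)) k :: 'a :: comm_ring_1 poly)"
proof -
  have "[:1, 1:] ^ m = (monom 1 1 + 1 :: 'a poly) ^ m"
    by (simp add: monom_altdef one_pCons)
  also have "\<dots> = (\<Sum>k\<le>m. monom (of_nat (m choose k)) k)"
    by (simp add: binomial_ring monom_power of_nat_poly smult_monom)
  finally show ?thesis .
qed

lemma pcompose_power: "(p ^ m) \<circ>\<^sub>p r = (p \<circ>\<^sub>p r) ^ m"
  for p r :: "'a :: comm_ring_1 poly"
  by (induction m) (simp_all add: pcompose_mult pcompose_1)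

text \<open>By linearity it suffices to treat monomials. There
  \<open>(-1 - x)^m = (-1)^m (1 + x)^m\<close>, and \<open>bernoulli_reflect\<close> evaluates
  \<open>L((1 + x)^m)\<close> with a second sign \<open>(-1)^m\<close> that cancels the
  first.\<close>

lemma bernoulli_umbral_reflect:
  "bernoulli_umbral (p \<circ>\<^sub>p [:-1, -1:]) = bernoulli_umbral p"
proof -
  have reflect_monom: "monom c m \<circ>\<^sub>p [:-1, -1:] = smult (c * (-1) ^ m) ([:1, 1:] ^ m)"
    for c :: real and m
  proof -
    have "monom c m \<circ>\<^sub>p [:-1, -1:] = smult c ([:-1, -1:] ^ m)"
      by (simp add: monom_altdef pcompose_smult pcompose_power pcompose_pCons)
    also have "[:-1, -1:] ^ m = smult ((-1) ^ m) ([:1, 1 :: real:] ^ m)"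
      using smult_power[of "-1" "[:1, 1 :: real:]" m] by simp
    finally show ?thesis
      by simp
  qed
  have umbral_monom: "bernoulli_umbral (monom c m \<circ>\<^sub>p [:-1, -1:]) = c * bernoulli m" for c m
  proof -
    have "bernoulli_umbral (monom c m \<circ>\<^sub>p [:-1, -1:])
        = c * (-1) ^ m * (\<Sum>k\<le>m. real (m choose k) * bernoulli k)"
      by (simp only: reflect_monom bernoulli_umbral_smult one_plus_X_power bernoulli_umbral_sum
          bernoulli_umbral_monom)
    also have "\<dots> = c * bernoulli m * ((-1) ^ m * (-1) ^ m)"
      unfolding bernoulli_reflect by (simp only: mult_ac)
    also have "(-1) ^ m * (-1) ^ m = (1 :: real)"
      by (simp flip: power_mult_distrib)
    finally show ?thesis
      by simp
  qed
  have "p \<circ>\<^sub>p [:-1, -1:] = (\<Sum>i\<le>degree p. monom (coeff p i) i \<circ>\<^sub>p [:-1, -1:])"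
    by (simp only: pcompose_sum[symmetric] poly_as_sum_of_monoms)
  then show ?thesis
    by (simp only: bernoulli_umbral_sum umbral_monom bernoulli_umbral_def[of p])
qed

text \<open>Chain rule: each differentiation brings out the inner derivative
  \<open>-1\<close>.\<close>

lemma higher_pderiv_reflect:
  "(pderiv ^^ q) (p \<circ>\<^sub>p [:-1, -1:]) = smult ((-1) ^ q) ((pderiv ^^ q) p \<circ>\<^sub>p [:-1, -1 :: real:])"
  by (induction q) (simp_all add: pderiv_smult pderiv_pcompose pderiv_pCons)

lemma higher_pderiv_monom_add:
  "(pderiv ^^ q) (monom c (m + q)) = monom (pochhammer (of_nat (Suc m)) q * c) m"
  by (rule poly_eqI) (auto simp: coeff_higher_pderiv)

theorem theorem4p2:
  fixes n q :: nat
  assumes "q \<ge> 1" and "odd q"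
  shows "(\<Sum>k = 0..n + q. real ((n + q) choose k) * (\<Prod>j = 1..q. real (n + k + j)) * bernoulli (n + k)) = 0"
proof -
  define N where "N = n + q"
  define G :: "real poly" where "G = [:0, 1:] ^ N * [:1, 1:] ^ N"
  define P where "P = (pderiv ^^ q) G"
  \<comment> \<open>The reflection sends \<open>x\<close> to \<open>-(1 + x)\<close> and
    \<open>1 + x\<close> to \<open>-x\<close>; the two signs cancel in the product.\<close>
  have "G \<circ>\<^sub>p [:-1, -1:] = [:-1, -1:] ^ N * [:0, -1:] ^ N"
    by (simp add: G_def pcompose_mult pcompose_power pcompose_pCons)
  also have "\<dots> = G"
    by (simp add: G_def flip: power_mult_distrib)
  finally have "P = smult ((-1) ^ q) (P \<circ>\<^sub>p [:-1, -1:])"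
    unfolding P_def by (metis higher_pderiv_reflect)
  with \<open>odd q\<close> have "bernoulli_umbral P = - bernoulli_umbral P"
    by (metis bernoulli_umbral_reflect bernoulli_umbral_smult mult_minus1 power_minus_odd power_one)
  then have "bernoulli_umbral P = 0"
    by simp
  have "G = (\<Sum>k\<le>N. monom (real (N choose k)) (N + k))"
    by (simp add: G_def one_plus_X_power monom_altdef sum_distrib_left power_add)
  \<comment> \<open>Splitting off \<open>q\<close> in the exponent shows that \<open>q\<close>
    differentiations leave \<open>x^(n + k)\<close>, which \<open>L\<close> sends to
    \<open>bernoulli (n + k)\<close>.\<close>
  also have "\<dots> = (\<Sum>k\<le>N. monom (real (N choose k)) (n + k + q))"
    by (simp add: N_def add_ac)
  finally have "G = \<dots>" .
  then have "P = (\<Sum>k\<le>N. monom (pochhammer (real (n + k + 1)) q * real (N choose k)) (n + k))"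
    by (simp add: P_def higher_pderiv_sum higher_pderiv_monom_add)
  then have "bernoulli_umbral P
      = (\<Sum>k\<le>N. pochhammer (real (n + k + 1)) q * real (N choose k) * bernoulli (n + k))"
    by (simp add: bernoulli_umbral_sum bernoulli_umbral_monom)
  \<comment> \<open>The rising factorial counts its factors from 0, the stated product from 1; the
    base \<open>n + k + 1\<close> absorbs the shift.\<close>
  moreover have "pochhammer (real (n + k + 1)) q = (\<Prod>j = 1..q. real (n + k + j))" for k
    by (simp add: pochhammer_prod prod.atLeast1_atMost_eq add_ac lessThan_atLeast0)
  ultimately show ?thesis
    using \<open>bernoulli_umbral P = 0\<close> by (simp add: N_def atLeast0AtMost mult_ac)
qed

end
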